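(* Let $\mathcal{C}_0$ be an $[n,k,d]$-linear code over $\mathbb{F}_q$ with parity-check matrix $H_0\in\mathbb{F}_q^{(n-k)\times n}$, and let $r$ be a positive integer. Let $H$ be the lengthened matrix with $n-k+\lceil n/r\rceil$ rows and $n+\lceil n/r\rceil$ columns obtained from $H_0$ and $r$ as described in the context, and let $\mathcal{C}$ be the code over $\mathbb{F}_q$ with $H$ as its parity-check matrix. Then $\mathcal{C}$ is an $[n+\lceil \frac{n}{r}\rceil,\,k,\,\ge d;\,r]_q$-locally repairable code.
   Context: Construction of $H$: write $n=mr+s$ with integers $m\ge 0$ and $1\le s\le r$, so $\lceil n/r\rceil=m+1$. Divide the columns of $H_0$, in order, into $m+1$ blocks: block $i$ ($1\le i\le m$) consists of $\mathbf{h}_{i1},\dots,\mathbf{h}_{ir}$ and block $m+1$ of $\mathbf{h}_{m+1,1},\dots,\mathbf{h}_{m+1,s}$. Put $s_i=r$ for $i\le m$ and $s_{m+1}=s$. Let $\mathbf{e}_1,\dots,\mathbf{e}_{m+1}$ be the standard basis (column) vectors of $\mathbb{F}_q^{m+1}$. The columns of $H$ are grouped in $m+1$ blocks; block $i$ has $s_i+1$ columns, namely $\binom{\mathbf{e}_i}{\mathbf{h}_{ij}}$ for $1\le j\le s_i$, followed by $\binom{\mathbf{e}_i}{\mathbf{0}}$, where $\mathbf{0}$ is the zero vector of dimension $n-k$. An $[n,k,d]_q$-linear code is a $k$-dimensional nonzero subspace of $\mathbb{F}_q^n$ with minimum Hamming distance $d$ ($\ge d$: at least $d$). It has locality $r$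 if for every coordinate $i$ there is a set $R\subseteq[n]\setminus\{i\}$, $|R|\le r$, such that codewords agreeing on $R$ also agree at $i$; equivalently, every coordinate $i$ lies in the support of some dual codeword of weight at most $r+1$. An $[n,k,d;r]_q$-locally repairable code is an $[n,k,d]_q$-linear code with locality $r$. *)

theory Defs
  imports Complex_Main "Jordan_Normal_Form.Matrix_Kernel"
begin

section \<open>Linear codes\<close>

text \<open>Words are vectors of type \<open>'a vec\<close> over a finite field \<open>'a\<close>; coordinates are numbered
  from \<open>0\<close>. Both \<open>VectorSpace\<close> and \<open>Real_Vector_Spaces\<close> have a constant \<open>subspace\<close>, hence the
  qualified name.\<close>

definition linear_code :: "nat \<Rightarrow> nat \<Rightarrow> 'a::field vec set \<Rightarrow> bool" where
  "linear_code n k C \<longleftrightarrow>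
     VectorSpace.subspace class_ring C (module_vec TYPE('a) n) \<and>
     C \<noteq> {0\<^sub>v n} \<and>
     vectorspace.dim class_ring ((module_vec TYPE('a) n)\<lparr>carrier := C\<rparr>) = k"

definition hamming_dist :: "'a vec \<Rightarrow> 'a vec \<Rightarrow> nat" where
  "hamming_dist x y = card {i. i < dim_vec x \<and> x $ i \<noteq> y $ i}"

text \<open>Only meaningful for a finite code with at least two codewords, in particular for a
  \<^const>\<open>linear_code\<close> over a finite field.\<close>

definition min_dist :: "'a vec set \<Rightarrow> nat" where
  "min_dist C = Min {hamming_dist x y | x y. x \<in> C \<and> y \<in> C \<and> x \<noteq> y}"

definition parity_check_matrix :: "'a::field mat \<Rightarrow> 'a vec set \<Rightarrow> bool" where
  "parity_check_matrix H C \<longleftrightarrow> C = mat_kernel H"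

definition has_locality :: "nat \<Rightarrow> nat \<Rightarrow> 'a vec set \<Rightarrow> bool" where
  "has_locality n r C \<longleftrightarrow>
     (\<forall>i<n. \<exists>R. R \<subseteq> {..<n} - {i} \<and> card R \<le> r \<and>
        (\<forall>x\<in>C. \<forall>y\<in>C. (\<forall>j\<in>R. x $ j = y $ j) \<longrightarrow> x $ i = y $ i))"

text \<open>\<open>[n, k, d]\<close> codes, and \<open>[n, k, \<ge> d; r]\<close> locally repairable codes.\<close>

definition nkd_code :: "nat \<Rightarrow> nat \<Rightarrow> nat \<Rightarrow> 'a::{field,finite} vec set \<Rightarrow> bool" where
  "nkd_code n k d C \<longleftrightarrow> linear_code n k C \<and> min_dist C = d"

definition lrc_at_least :: "nat \<Rightarrow> nat \<Rightarrow> nat \<Rightarrow> nat \<Rightarrow> 'a::{field,finite} vec set \<Rightarrow> bool" where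
  "lrc_at_least n k d r C \<longleftrightarrow> linear_code n k C \<and> d \<le> min_dist C \<and> has_locality n r C"

section \<open>The lengthened matrix\<close>

text \<open>The \<open>m\<close> and \<open>s\<close> of the decomposition \<open>n = m r + s\<close> with \<open>1 \<le> s \<le> r\<close>; see
  \<open>block_decomposition\<close> below.\<close>

definition full_blocks :: "nat \<Rightarrow> nat \<Rightarrow> nat" where
  "full_blocks n r = (n - 1) div r"

definition last_block_size :: "nat \<Rightarrow> nat \<Rightarrow> nat" where
  "last_block_size n r = (n - 1) mod r + 1"

definition block_size :: "nat \<Rightarrow> nat \<Rightarrow> nat \<Rightarrow> nat" where
  "block_size n r i = (if i < full_blocks n r then r else last_block_size n r)"

text \<open>Blocks and the positions within them are numbered from \<open>0\<close>, so the \<open>j\<close>-th column of \<open>H0\<close>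
  in block \<open>i\<close> is column \<open>i * r + j\<close> of \<open>H0\<close>.\<close>

definition lengthened_block :: "'a::field mat \<Rightarrow> nat \<Rightarrow> nat \<Rightarrow> 'a vec list" where
  "lengthened_block H0 r i =
     (let e = unit_vec (full_blocks (dim_col H0) r + 1) i in
      map (\<lambda>j. e @\<^sub>v col H0 (i * r + j)) [0..<block_size (dim_col H0) r i]
      @ [e @\<^sub>v 0\<^sub>v (dim_row H0)])"

definition lengthened_matrix :: "'a::field mat \<Rightarrow> nat \<Rightarrow> 'a mat" where
  "lengthened_matrix H0 r =
     (let m = full_blocks (dim_col H0) r in
      mat_of_cols (m + 1 + dim_row H0) (concat (map (lengthened_block H0 r) [0..<m + 1])))"

lemma block_decomposition:
  assumes "0 < n" "0 < r"
  shows "n = full_blocks n r * r + last_block_size n r"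
    and "1 \<le> last_block_size n r" "last_block_size n r \<le> r"
    and "nat \<lceil>real n / real r\<rceil> = full_blocks n r + 1"
proof -
  define m s where "m = full_blocks n r" and "s = last_block_size n r"
  show n: "n = full_blocks n r * r + last_block_size n r"
    using assms div_mult_mod_eq[of "n - 1" r]
    by (simp add: full_blocks_def last_block_size_def)
  show s1: "1 \<le> last_block_size n r"
    by (simp add: last_block_size_def)
  show sr: "last_block_size n r \<le> r"
    using mod_less_divisor[OF assms(2), of "n - 1"] unfolding last_block_size_def by linarith
  have n': "real n = real m * real r + real s"
    using n unfolding m_def s_def by (metis of_nat_add of_nat_mult)
  have "real n / real r = real m + real s / real r"
    using assms(2) by (simp add: n' field_simps)
  moreover have "0 < real s / real r" "real s / real r \<le> 1"
    using s1 sr assms(2) unfolding s_def by simp_all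
  ultimately have "\<lceil>real n / real r\<rceil> = int m + 1"
    by (intro ceiling_unique) simp_all
  then show "nat \<lceil>real n / real r\<rceil> = full_blocks n r + 1"
    unfolding m_def by simp
qed

lemma lengthened_matrix_carrier:
  assumes "H0 \<in> carrier_mat a n" "0 < n" "0 < r"
  shows "lengthened_matrix H0 r
           \<in> carrier_mat (a + nat \<lceil>real n / real r\<rceil>) (n + nat \<lceil>real n / real r\<rceil>)"
proof -
  let ?m = "full_blocks n r"
  have len: "length (lengthened_block H0 r i) = block_size n r i + 1" for i
    using assms(1) by (simp add: lengthened_block_def Let_def)
  have "map (\<lambda>i. block_size n r i + 1) [0..<?m] = map (\<lambda>i. r + 1) [0..<?m]"
    by (rule map_cong) (simp_all add: block_size_def)
  then have "sum_list (map (\<lambda>i. block_size n r i + 1) [0..<?m]) = ?m * (r + 1)"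
    by (simp only: sum_list_triv length_upt) simp
  then have "length (concat (map (lengthened_block H0 r) [0..<?m + 1]))
      = ?m * (r + 1) + last_block_size n r + 1"
    by (simp add: length_concat len comp_def block_size_def[of n r "full_blocks n r"])
  also have "\<dots> = n + (?m + 1)"
    using block_decomposition(1)[OF assms(2,3)] by simp
  finally show ?thesis
    using assms(1) block_decomposition(4)[OF assms(2,3)]
    by (auto simp: lengthened_matrix_def Let_def)
qed

end

theory Submission
  imports Defs
begin

text \<open>Deleting the \<open>\<lceil>n/r\<rceil>\<close> added coordinates maps \<open>C\<close> linearly to \<open>C0\<close>. The rows
  \<open>\<Sum> (coordinates of block i) = 0\<close> determine every deleted coordinate from the rest of its block,
  so this map is bijective, which gives the dimension. Distinct codewords of \<open>C\<close> have distinct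
  images, whose distance is no larger, which gives the minimum distance. The same rows yield the
  locality.\<close>

section \<open>Indexing the columns\<close>

text \<open>Column \<open>j\<close> of block \<open>i\<close> of the lengthened matrix has index \<open>i * Suc r + j\<close>, in the last,
  possibly shorter, block too.\<close>

definition data_index :: "nat \<Rightarrow> nat \<Rightarrow> nat" where
  "data_index r c = c div r * Suc r + c mod r"

text \<open>The position of the column \<open>(e_i, 0)\<close> that closes block i. In the last
  block its offset is \<open>last_block_size n r\<close>, which may be smaller than r.\<close>

definition parity_index :: "nat \<Rightarrow> nat \<Rightarrow> nat \<Rightarrow> nat" where
  "parity_index n r i = i * Suc r + block_size n r i"

text \<open>For positive n and r this is n + ceil(n/r), kept free of real numbers.\<close>

definition lengthened_dim :: "nat \<Rightarrow> nat \<Rightarrow> nat" where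
  "lengthened_dim n r = n + full_blocks n r + 1"

text \<open>For \<open>i \<le> full_blocks n r\<close>, the support of row i of the lengthened
  matrix, hence of the dual codeword responsible for locality.\<close>

definition block_indices :: "nat \<Rightarrow> nat \<Rightarrow> nat \<Rightarrow> nat set" where
  "block_indices n r i = {p. p < lengthened_dim n r \<and> p div Suc r = i}"

text \<open>The bound includes \<open>j = r\<close> because a full block has r + 1 columns, its
  parity column sitting at offset r.\<close>

lemma div_mod_Suc_mult_add:
  assumes "j \<le> r"
  shows "(i * Suc r + j) div Suc r = i" "(i * Suc r + j) mod Suc r = j"
proof -
  have "j < Suc r"
    using assms by simp
  then have "(j + i * Suc r) div Suc r = i" "(j + i * Suc r) mod Suc r = j"
    by (simp_all only: div_mult_self1 mod_mult_self1 div_less mod_less)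
  then show "(i * Suc r + j) div Suc r = i" "(i * Suc r + j) mod Suc r = j"
    by (simp_all only: add.commute)
qed

lemma data_index_div_mod:
  assumes "0 < r"
  shows "data_index r c div Suc r = c div r" "data_index r c mod Suc r = c mod r"
proof -
  have "c mod r \<le> r"
    using assms by (simp add: less_imp_le)
  then show "data_index r c div Suc r = c div r" "data_index r c mod Suc r = c mod r"
    unfolding data_index_def by (rule div_mod_Suc_mult_add)+
qed

lemma inj_data_index:
  assumes "0 < r"
  shows "inj_on (data_index r) A"
  by (rule inj_onI) (metis data_index_div_mod[OF assms] div_mult_mod_eq)

lemma finite_block_indices: "finite (block_indices n r i)"
  by (simp add: block_indices_def)

lemma lengthened_dim_ceiling:
  assumes "0 < n" "0 < r"
  shows "lengthened_dim n r = n + nat \<lceil>real n / real r\<rceil>"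
  using block_decomposition(4)[OF assms] by (simp add: lengthened_dim_def)

context
  fixes n r :: nat
  assumes n: "0 < n" and r: "0 < r"
begin

lemma block_size_bounds: "1 \<le> block_size n r i" "block_size n r i \<le> r"
  using block_decomposition(2,3)[OF n r] r by (auto simp: block_size_def)

lemma lengthened_dim_eq:
  "lengthened_dim n r = full_blocks n r * Suc r + last_block_size n r + 1"
  using block_decomposition(1)[OF n r] by (simp add: lengthened_dim_def)

text \<open>Each block before the last occupies \<open>Suc r\<close> indices, the last one only
  \<open>last_block_size n r + 1\<close>. Hence the largest admissible offset in a block is that of
  its parity column.\<close>

lemma index_less_lengthened_dim_iff:
  assumes "j \<le> r"
  shows "i * Suc r + j < lengthened_dim n r \<longleftrightarrow> i \<le> full_blocks n r \<and> j \<le> block_size n r i"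
proof -
  let ?m = "full_blocks n r" and ?s = "last_block_size n r"
  have s: "?s \<le> r"
    using block_decomposition(3)[OF n r] .
  consider "i < ?m" | "i = ?m" | "?m < i"
    by linarith
  then show ?thesis
  proof cases
    case 1
    then have "Suc i * Suc r \<le> ?m * Suc r"
      by (intro mult_right_mono) auto
    with 1 assms show ?thesis
      by (simp add: lengthened_dim_eq block_size_def)
  next
    case 2
    then show ?thesis
      by (simp add: lengthened_dim_eq block_size_def less_Suc_eq_le)
  next
    \<comment> \<open>Since \<open>?s \<le> r\<close>, the last block ends no later than the first
      index of block \<open>Suc ?m\<close>.\<close>
    case 3
    then have "Suc ?m * Suc r \<le> i * Suc r"
      by (intro mult_right_mono) auto
    with 3 s show ?thesis
      by (simp add: lengthened_dim_eq)
  qed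
qed

lemma div_less_full_blocks:
  assumes "c < n"
  shows "c div r \<le> full_blocks n r" "c mod r < block_size n r (c div r)"
proof -
  let ?m = "full_blocks n r" and ?s = "last_block_size n r"
  have c: "c div r * r + c mod r < ?m * r + ?s"
    using assms block_decomposition(1)[OF n r] by simp
  have "c \<le> n - 1"
    using assms by simp
  then show m: "c div r \<le> ?m"
    unfolding full_blocks_def by (rule div_le_mono)
  show "c mod r < block_size n r (c div r)"
  proof (cases "c div r < ?m")
    case True
    then show ?thesis
      using r by (simp add: block_size_def)
  next
    case False
    with m have "c div r = ?m"
      by simp
    with c show ?thesis
      by (simp add: block_size_def)
  qed
qed

lemma parity_index_div_mod:
  "parity_index n r i div Suc r = i" "parity_index n r i mod Suc r = block_size n r i"
  unfolding parity_index_def by (rule div_mod_Suc_mult_add[OF block_size_bounds(2)])+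

text \<open>Equal indices would have the same block number and the same offset, but data offsets are
  strictly below the block size.\<close>

lemma data_index_neq_parity_index:
  assumes "c < n"
  shows "data_index r c \<noteq> parity_index n r i"
  using div_less_full_blocks(2)[OF assms]
  by (metis data_index_div_mod[OF r] parity_index_div_mod less_irrefl)

lemma data_index_less:
  assumes "c < n"
  shows "data_index r c < lengthened_dim n r"
proof -
  have "c mod r \<le> r"
    using r by (simp add: less_imp_le)
  from index_less_lengthened_dim_iff[OF this] show ?thesis
    unfolding data_index_def using div_less_full_blocks[OF assms] by (simp del: mult_Suc_right)
qed

lemma parity_index_less:
  assumes "i \<le> full_blocks n r"
  shows "parity_index n r i < lengthened_dim n r"
  unfolding parity_index_def
  using index_less_lengthened_dim_iff[OF block_size_bounds(2)] assms by simp

lemma block_of_index: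
  assumes "p < lengthened_dim n r"
  shows "p div Suc r \<le> full_blocks n r" "p mod Suc r \<le> block_size n r (p div Suc r)"
proof -
  have "p mod Suc r \<le> r"
    using mod_less_divisor[of "Suc r" p] by linarith
  note iff = index_less_lengthened_dim_iff[OF this, of "p div Suc r"]
  have "p div Suc r * Suc r + p mod Suc r < lengthened_dim n r"
    using assms by (simp only: div_mult_mod_eq)
  then show "p div Suc r \<le> full_blocks n r" "p mod Suc r \<le> block_size n r (p div Suc r)"
    unfolding iff by simp_all
qed

text \<open>The offset decides: equal to the block size means parity, smaller means data. Claims
  about all coordinates can then be checked on the two kinds separately.\<close>

lemma index_cases:
  assumes "p < lengthened_dim n r"
  obtains (data) c where "c < n" "p = data_index r c"
  | (parity) i where "i \<le> full_blocks n r" "p = parity_index n r i"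
proof (cases "p mod Suc r = block_size n r (p div Suc r)")
  case True
  then have "p = parity_index n r (p div Suc r)"
    unfolding parity_index_def by (metis div_mult_mod_eq)
  with block_of_index(1)[OF assms] show ?thesis
    by (rule parity)
next
  case False
  let ?i = "p div Suc r" and ?j = "p mod Suc r" and ?m = "full_blocks n r"
  have j: "?j < block_size n r ?i" and i: "?i \<le> ?m"
    using False block_of_index[OF assms] by simp_all
  \<comment> \<open>Inverts \<open>data_index\<close>: the same quotient and remainder are
    recombined in base r, which is legitimate because \<open>?j < r\<close>.\<close>
  define c where "c = ?i * r + ?j"
  have jr: "?j < r"
    using j block_size_bounds(2)[of ?i] by linarith
  then have c: "c div r = ?i" "c mod r = ?j"
    unfolding c_def by simp_all
  have "p = data_index r c"
    unfolding data_index_def c by (simp only: div_mult_mod_eq)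
  moreover have "c < n"
  \<comment> \<open>With n = m r + s: in a full block c < (i + 1) r \<le> m r, and in the last block
    the offset is below s.\<close>
  proof (cases "?i < ?m")
    case True
    then have "Suc ?i * r \<le> ?m * r"
      by (intro mult_right_mono) auto
    then have "c < ?m * r"
      using jr by (simp add: c_def)
    then show ?thesis
      using block_decomposition(1)[OF n r] by linarith
  next
    case False
    with i have "?i = ?m"
      by simp
    with j have "c < ?m * r + last_block_size n r"
      by (simp add: c_def block_size_def)
    then show ?thesis
      using block_decomposition(1)[OF n r] by linarith
  qed
  ultimately show ?thesis
    by (intro data)
qed

lemma block_indices_eq:
  assumes "i \<le> full_blocks n r"
  shows "block_indices n r i =
    insert (parity_index n r i) (data_index r ` {c. c < n \<and> c div r = i})"
proof (intro equalityI subsetI)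
  fix p
  assume "p \<in> block_indices n r i"
  then have p: "p < lengthened_dim n r" and "p div Suc r = i"
    by (simp_all add: block_indices_def)
  from p this(2) show "p \<in> insert (parity_index n r i) (data_index r ` {c. c < n \<and> c div r = i})"
    by (cases rule: index_cases) (auto simp: data_index_div_mod[OF r] parity_index_div_mod)
next
  fix p
  assume "p \<in> insert (parity_index n r i) (data_index r ` {c. c < n \<and> c div r = i})"
  then show "p \<in> block_indices n r i"
    using assms parity_index_less data_index_less
    by (auto simp: block_indices_def data_index_div_mod[OF r] parity_index_div_mod)
qed

text \<open>Only \<open>Suc r\<close> offsets exist within a block. Removing the coordinate to be
  repaired leaves at most r, which is the locality bound.\<close>

lemma card_block_indices_le: "card (block_indices n r i) \<le> Suc r"
proof -
  have "block_indices n r i \<subseteq> (\<lambda>j. i * Suc r + j) ` {..<Suc r}"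
  proof
    fix p
    assume "p \<in> block_indices n r i"
    then have "p = i * Suc r + p mod Suc r"
      by (metis (mono_tags, lifting) block_indices_def div_mult_mod_eq mem_Collect_eq)
    moreover have "p mod Suc r < Suc r"
      by simp
    ultimately show "p \<in> (\<lambda>j. i * Suc r + j) ` {..<Suc r}"
      by blast
  qed
  then have "card (block_indices n r i) \<le> card {..<Suc r}"
    by (rule surj_card_le[OF finite_lessThan])
  then show ?thesis
    by simp
qed

text \<open>Isolates the parity entry, so that a vanishing block sum can be solved for it.\<close>

lemma sum_block_indices:
  fixes f :: "nat \<Rightarrow> 'b::comm_monoid_add"
  assumes "i \<le> full_blocks n r"
  shows "sum f (block_indices n r i) =
    f (parity_index n r i) + (\<Sum>c | c < n \<and> c div r = i. f (data_index r c))"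
proof -
  have "parity_index n r i \<notin> data_index r ` {c. c < n \<and> c div r = i}"
    by (auto simp: data_index_neq_parity_index[THEN not_sym])
  then show ?thesis
    by (simp add: block_indices_eq[OF assms] sum.reindex[OF inj_data_index[OF r]])
qed

end

section \<open>Entries and kernel of the lengthened matrix\<close>

text \<open>Column p in closed form, decoded from quotient and remainder of p by
  \<open>Suc r\<close>. It replaces lookups in a concatenation of lists.\<close>

definition lengthened_col :: "'a::field mat \<Rightarrow> nat \<Rightarrow> nat \<Rightarrow> 'a vec" where
  "lengthened_col H0 r p =
     unit_vec (full_blocks (dim_col H0) r + 1) (p div Suc r) @\<^sub>v
     (if p mod Suc r = block_size (dim_col H0) r (p div Suc r) then 0\<^sub>v (dim_row H0)
      else col H0 (p div Suc r * r + p mod Suc r))"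

definition puncture :: "nat \<Rightarrow> nat \<Rightarrow> 'a vec \<Rightarrow> 'a vec" where
  "puncture n r x = vec n (\<lambda>c. x $ data_index r c)"

lemma dim_puncture [simp]: "dim_vec (puncture n r x) = n"
  by (simp add: puncture_def)

lemma puncture_index [simp]: "c < n \<Longrightarrow> puncture n r x $ c = x $ data_index r c"
  by (simp add: puncture_def)

context
  fixes H0 :: "'a::field mat" and n r a :: nat
  assumes H0: "H0 \<in> carrier_mat a n" and n: "0 < n" and r: "0 < r"
begin

lemma lengthened_block_eq:
  "lengthened_block H0 r i =
     map (lengthened_col H0 r) [i * Suc r..<i * Suc r + Suc (block_size n r i)]"
proof -
  let ?l = "block_size n r i"
  have l: "?l \<le> r"
    by (rule block_size_bounds(2)[OF n r])
  have "map (lengthened_col H0 r) [i * Suc r..<i * Suc r + Suc ?l] =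
      map (\<lambda>j. lengthened_col H0 r (i * Suc r + j)) [0..<Suc ?l]"
    by (rule nth_equalityI) (simp_all del: upt_Suc mult_Suc_right)
  also have "\<dots> = map (\<lambda>j. lengthened_col H0 r (i * Suc r + j)) [0..<?l] @
      [lengthened_col H0 r (i * Suc r + ?l)]"
    by simp
  also have "\<dots> = lengthened_block H0 r i"
    using l H0
    by (auto simp: lengthened_block_def lengthened_col_def Let_def div_mod_Suc_mult_add
        simp del: mult_Suc_right)
  finally show ?thesis ..
qed

text \<open>The bound on k restricts this to blocks before the last, all with r + 1 columns, so
  their index intervals join seamlessly. The last block is appended in
  \<open>lengthened_matrix_eq\<close>.\<close>

lemma concat_lengthened_blocks:
  assumes "k \<le> full_blocks n r"
  shows "concat (map (lengthened_block H0 r) [0..<k]) = map (lengthened_col H0 r) [0..<k * Suc r]"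
  using assms
proof (induction k)
  case 0
  then show ?case
    by simp
next
  case (Suc k)
  then have "block_size n r k = r"
    by (simp add: block_size_def)
  then have "lengthened_block H0 r k = map (lengthened_col H0 r) [k * Suc r..<Suc k * Suc r]"
    by (simp add: lengthened_block_eq ac_simps del: upt_Suc)
  moreover have "[0..<Suc k * Suc r] = [0..<k * Suc r] @ [k * Suc r..<Suc k * Suc r]"
    by (metis add.commute le0 mult_Suc upt_add_eq_append)
  ultimately show ?case
    using Suc by (simp del: mult_Suc mult_Suc_right)
qed

lemma lengthened_matrix_eq:
  "lengthened_matrix H0 r =
     mat_of_cols (full_blocks n r + 1 + a) (map (lengthened_col H0 r) [0..<lengthened_dim n r])"
proof -
  let ?m = "full_blocks n r"
  have "lengthened_dim n r = ?m * Suc r + Suc (block_size n r ?m)"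
    by (simp add: lengthened_dim_eq[OF n r] block_size_def)
  then have "[0..<lengthened_dim n r] =
      [0..<?m * Suc r] @ [?m * Suc r..<?m * Suc r + Suc (block_size n r ?m)]"
    using upt_add_eq_append[OF le0] by metis
  moreover have "concat (map (lengthened_block H0 r) [0..<?m + 1]) =
      concat (map (lengthened_block H0 r) [0..<?m]) @ lengthened_block H0 r ?m"
    by simp
  ultimately have "concat (map (lengthened_block H0 r) [0..<?m + 1]) =
      map (lengthened_col H0 r) [0..<lengthened_dim n r]"
    by (simp only: concat_lengthened_blocks[OF order_refl] lengthened_block_eq map_append)
  then show ?thesis
    using H0 by (simp add: lengthened_matrix_def Let_def del: upt_Suc)
qed

lemma lengthened_matrix_carrier':
  "lengthened_matrix H0 r \<in> carrier_mat (full_blocks n r + 1 + a) (lengthened_dim n r)"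
  by (auto simp: lengthened_matrix_eq)

section \<open>Matrix entries and the parity-check equations\<close>

lemma lengthened_matrix_index_top:
  assumes "i \<le> full_blocks n r" "p < lengthened_dim n r"
  shows "lengthened_matrix H0 r $$ (i, p) = (if p div Suc r = i then 1 else 0)"
  using assms H0 by (auto simp: lengthened_matrix_eq mat_of_cols_def lengthened_col_def unit_vec_def)

lemma lengthened_matrix_index_bottom:
  assumes "t < a"
  shows "c < n \<Longrightarrow> lengthened_matrix H0 r $$ (full_blocks n r + 1 + t, data_index r c) = H0 $$ (t, c)"
    and "i \<le> full_blocks n r \<Longrightarrow>
      lengthened_matrix H0 r $$ (full_blocks n r + 1 + t, parity_index n r i) = 0"
proof -
  let ?m = "full_blocks n r"
  have entry: "lengthened_matrix H0 r $$ (?m + 1 + t, p) =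
      (if p mod Suc r = block_size n r (p div Suc r) then 0\<^sub>v a
       else col H0 (p div Suc r * r + p mod Suc r)) $ t" if "p < lengthened_dim n r" for p
    using that assms H0 by (simp add: lengthened_matrix_eq mat_of_cols_def lengthened_col_def)
  show "lengthened_matrix H0 r $$ (?m + 1 + t, data_index r c) = H0 $$ (t, c)" if "c < n"
    unfolding entry[OF data_index_less[OF n r that]] data_index_div_mod[OF r] div_mult_mod_eq
    using that assms H0 div_less_full_blocks(2)[OF n r that] by simp
  show "lengthened_matrix H0 r $$ (?m + 1 + t, parity_index n r i) = 0" if "i \<le> ?m"
    unfolding entry[OF parity_index_less[OF n r that]] parity_index_div_mod[OF n r]
    using assms by simp
qed

text \<open>Row i is the indicator vector of block i, because every column of that block starts with
  \<open>e_i\<close>.\<close>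

lemma lengthened_mult_top:
  assumes "x \<in> carrier_vec (lengthened_dim n r)" "i \<le> full_blocks n r"
  shows "(lengthened_matrix H0 r *\<^sub>v x) $ i = (\<Sum>p\<in>block_indices n r i. x $ p)"
proof -
  have "(lengthened_matrix H0 r *\<^sub>v x) $ i =
      (\<Sum>p = 0..<lengthened_dim n r. lengthened_matrix H0 r $$ (i, p) * x $ p)"
    using assms lengthened_matrix_carrier' by (simp add: scalar_prod_def)
  also have "\<dots> = (\<Sum>p = 0..<lengthened_dim n r. if p div Suc r = i then x $ p else 0)"
    using assms(2) by (intro sum.cong) (auto simp: lengthened_matrix_index_top)
  also have "\<dots> = (\<Sum>p\<in>block_indices n r i. x $ p)"
    by (rule sum.mono_neutral_cong_right) (auto simp: block_indices_def)
  finally show ?thesis .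
qed

text \<open>Parity columns vanish in the lower rows, so only data columns contribute; reindexing
  along \<open>data_index\<close> leaves a product with \<open>H0\<close>.\<close>

lemma lengthened_mult_bottom:
  assumes "x \<in> carrier_vec (lengthened_dim n r)" "t < a"
  shows "(lengthened_matrix H0 r *\<^sub>v x) $ (full_blocks n r + 1 + t) = (H0 *\<^sub>v puncture n r x) $ t"
proof -
  let ?f = "\<lambda>p. lengthened_matrix H0 r $$ (full_blocks n r + 1 + t, p) * x $ p"
  have "(lengthened_matrix H0 r *\<^sub>v x) $ (full_blocks n r + 1 + t) =
      (\<Sum>p = 0..<lengthened_dim n r. ?f p)"
    using assms lengthened_matrix_carrier' by (simp add: scalar_prod_def)
  also have "\<dots> = (\<Sum>p\<in>data_index r ` {0..<n}. ?f p)"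
  proof (rule sum.mono_neutral_right)
    show "data_index r ` {0..<n} \<subseteq> {0..<lengthened_dim n r}"
      using data_index_less[OF n r] by auto
    show "\<forall>p\<in>{0..<lengthened_dim n r} - data_index r ` {0..<n}. ?f p = 0"
    proof
      fix p
      assume p: "p \<in> {0..<lengthened_dim n r} - data_index r ` {0..<n}"
      then have "p < lengthened_dim n r"
        by simp
      from n r this p show "?f p = 0"
        by (cases rule: index_cases) (auto simp: lengthened_matrix_index_bottom(2)[OF assms(2), simplified])
    qed
  qed simp
  also have "\<dots> = (\<Sum>c = 0..<n. ?f (data_index r c))"
    by (simp add: sum.reindex[OF inj_data_index[OF r]])
  also have "\<dots> = (\<Sum>c = 0..<n. H0 $$ (t, c) * puncture n r x $ c)"
    by (intro sum.cong) (auto simp: lengthened_matrix_index_bottom(1)[OF assms(2), simplified])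
  also have "\<dots> = (H0 *\<^sub>v puncture n r x) $ t"
    using assms H0 by (simp add: scalar_prod_def)
  finally show ?thesis .
qed

text \<open>The upper rows demand zero block sums, the lower rows demand that the punctured word
  satisfy \<open>H0\<close>. The later arguments about individual codewords rest on this
  characterisation.\<close>

lemma mem_lengthened_kernel_iff:
  "x \<in> mat_kernel (lengthened_matrix H0 r) \<longleftrightarrow>
     x \<in> carrier_vec (lengthened_dim n r) \<and>
     (\<forall>i\<le>full_blocks n r. (\<Sum>p\<in>block_indices n r i. x $ p) = 0) \<and>
     puncture n r x \<in> mat_kernel H0"
proof (cases "x \<in> carrier_vec (lengthened_dim n r)")
  case x: True
  let ?m = "full_blocks n r" and ?y = "lengthened_matrix H0 r *\<^sub>v x"
  \<comment> \<open>A row q beyond \<open>?m\<close> is \<open>?m + 1 + t\<close> with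
    \<open>t = q - (?m + 1)\<close>; the subtraction is not truncated there.\<close>
  have split: "(\<forall>q<?m + 1 + a. P q) \<longleftrightarrow> (\<forall>i\<le>?m. P i) \<and> (\<forall>t<a. P (?m + 1 + t))" for P
  proof (intro iffI conjI allI impI)
    fix q
    assume *: "(\<forall>i\<le>?m. P i) \<and> (\<forall>t<a. P (?m + 1 + t))" and q: "q < ?m + 1 + a"
    show "P q"
    proof (cases "q \<le> ?m")
      case False
      then have "q = ?m + 1 + (q - (?m + 1))" "q - (?m + 1) < a"
        using q by simp_all
      then show ?thesis
        using * by metis
    qed (use * in blast)
  qed simp_all
  have "?y = 0\<^sub>v (?m + 1 + a) \<longleftrightarrow> (\<forall>q<?m + 1 + a. ?y $ q = 0)"
    using lengthened_matrix_carrier' by (auto simp: vec_eq_iff)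
  also have "\<dots> \<longleftrightarrow> (\<forall>i\<le>?m. ?y $ i = 0) \<and> (\<forall>t<a. ?y $ (?m + 1 + t) = 0)"
    by (rule split)
  also have "\<dots> \<longleftrightarrow> (\<forall>i\<le>?m. (\<Sum>p\<in>block_indices n r i. x $ p) = 0) \<and>
      (\<forall>t<a. (H0 *\<^sub>v puncture n r x) $ t = 0)"
    using lengthened_mult_top[OF x] lengthened_mult_bottom[OF x] by simp
  also have "(\<forall>t<a. (H0 *\<^sub>v puncture n r x) $ t = 0) \<longleftrightarrow> H0 *\<^sub>v puncture n r x = 0\<^sub>v a"
    using H0 by (auto simp: vec_eq_iff)
  finally show ?thesis
    using x by (simp add: mat_kernel[OF lengthened_matrix_carrier'] mat_kernel[OF H0] puncture_def)
qed (simp add: mat_kernel[OF lengthened_matrix_carrier'])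

section \<open>Puncturing as an isomorphism of kernels\<close>

lemma inj_on_puncture: "inj_on (puncture n r) (mat_kernel (lengthened_matrix H0 r))"
proof (rule inj_onI)
  fix x y
  assume x: "x \<in> mat_kernel (lengthened_matrix H0 r)"
    and y: "y \<in> mat_kernel (lengthened_matrix H0 r)"
    and eq: "puncture n r x = puncture n r y"
  have eq_data: "x $ data_index r c = y $ data_index r c" if "c < n" for c
    using that arg_cong[OF eq, of "\<lambda>v. v $ c"] by simp
  have "x $ p = y $ p" if p: "p < lengthened_dim n r" for p
    using n r p
  proof (cases rule: index_cases)
    case (data c)
    then show ?thesis
      using eq_data by blast
  next
    case (parity i)
    \<comment> \<open>Both block sums are zero and their data parts agree, so cancellation leaves
      equal parity entries.\<close>
    have "(\<Sum>p\<in>block_indices n r i. x $ p) = (\<Sum>p\<in>block_indices n r i. y $ p)"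
      using x y parity(1) by (simp add: mem_lengthened_kernel_iff)
    moreover have "(\<Sum>c | c < n \<and> c div r = i. x $ data_index r c) =
        (\<Sum>c | c < n \<and> c div r = i. y $ data_index r c)"
      by (intro sum.cong) (auto simp: eq_data)
    ultimately show ?thesis
      by (simp add: sum_block_indices[OF n r parity(1)] parity(2))
  qed
  then show "x = y"
    using x y by (auto simp: mem_lengthened_kernel_iff)
qed

lemma puncture_image: "puncture n r ` mat_kernel (lengthened_matrix H0 r) = mat_kernel H0"
proof (intro equalityI subsetI)
  fix v
  assume v: "v \<in> mat_kernel H0"
  then have vn: "v \<in> carrier_vec n"
    using H0 by (simp add: mat_kernel)
  \<comment> \<open>The preimage copies v to the data coordinates and sets each parity entry to
    minus the sum of the data in its block, making every block sum zero.\<close>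
  define x where "x = vec (lengthened_dim n r) (\<lambda>p.
    if p mod Suc r = block_size n r (p div Suc r) then - (\<Sum>c | c < n \<and> c div r = p div Suc r. v $ c)
    else v $ (p div Suc r * r + p mod Suc r))"
  have data: "x $ data_index r c = v $ c" if "c < n" for c
    using that div_less_full_blocks(2)[OF n r that]
    by (simp add: x_def data_index_less[OF n r] data_index_div_mod[OF r])
  have parity: "x $ parity_index n r i = - (\<Sum>c | c < n \<and> c div r = i. v $ c)"
    if "i \<le> full_blocks n r" for i
    using that by (simp add: x_def parity_index_less[OF n r] parity_index_div_mod[OF n r])
  have "puncture n r x = v"
    using vn by (intro eq_vecI) (simp_all add: data)
  moreover have "(\<Sum>p\<in>block_indices n r i. x $ p) = 0" if "i \<le> full_blocks n r" for i
  proof -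
    have "(\<Sum>c | c < n \<and> c div r = i. x $ data_index r c) = (\<Sum>c | c < n \<and> c div r = i. v $ c)"
      by (intro sum.cong) (auto simp: data)
    then show ?thesis
      by (simp add: sum_block_indices[OF n r that] parity[OF that])
  qed
  moreover have "x \<in> carrier_vec (lengthened_dim n r)"
    by (simp add: x_def)
  ultimately have "puncture n r x = v" "x \<in> mat_kernel (lengthened_matrix H0 r)"
    using v by (simp_all add: mem_lengthened_kernel_iff)
  then show "v \<in> puncture n r ` mat_kernel (lengthened_matrix H0 r)"
    by blast
qed (auto simp: mem_lengthened_kernel_iff)

lemma dim_lengthened_kernel:
  "vectorspace.dim class_ring
     ((module_vec TYPE('a) (lengthened_dim n r))\<lparr>carrier := mat_kernel (lengthened_matrix H0 r)\<rparr>) =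
   vectorspace.dim class_ring ((module_vec TYPE('a) n)\<lparr>carrier := mat_kernel H0\<rparr>)"
proof -
  interpret V: kernel "full_blocks n r + 1 + a" "lengthened_dim n r" "lengthened_matrix H0 r"
    by unfold_locales (rule lengthened_matrix_carrier')
  interpret W: kernel a n H0
    by unfold_locales (rule H0)
  have carrier: "x \<in> carrier_vec (lengthened_dim n r)"
    if "x \<in> mat_kernel (lengthened_matrix H0 r)" for x
    using that by (simp add: mem_lengthened_kernel_iff)
  \<comment> \<open>The carrier assumptions put \<open>data_index r c\<close> within the dimension,
    where entries of sums and multiples are computed pointwise.\<close>
  have add: "puncture n r (x + y) = puncture n r x + puncture n r y"
    if "x \<in> carrier_vec (lengthened_dim n r)" "y \<in> carrier_vec (lengthened_dim n r)" for x y :: "'a vec"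
    using that by (intro eq_vecI) (simp_all add: data_index_less[OF n r])
  have smult: "puncture n r (c \<cdot>\<^sub>v x) = c \<cdot>\<^sub>v puncture n r x"
    if "x \<in> carrier_vec (lengthened_dim n r)" for c and x :: "'a vec"
    using that by (intro eq_vecI) (simp_all add: data_index_less[OF n r])
  have "puncture n r \<in> mat_kernel (lengthened_matrix H0 r) \<rightarrow> mat_kernel H0"
    using puncture_image by blast
  then have "puncture n r \<in> LinearCombinations.module_hom class_ring V.VK W.VK"
    by (simp add: LinearCombinations.module_hom_def module_vec_simps carrier add smult)
  then interpret linear_map class_ring V.VK W.VK "puncture n r"
    by unfold_locales
  \<comment> \<open>A finite basis supplies the finite dimensionality required by
    \<open>dim_eq\<close>, which transfers the dimension along a linear bijection.\<close>
  obtain B where "finite B" "V.basis B"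
    using kernel_basis_exists[OF lengthened_matrix_carrier'] by blast
  then have "V.Ker.fin_dim"
    unfolding V.Ker.fin_dim_def V.Ker.basis_def by blast
  then show ?thesis
    by (rule dim_eq) (simp_all add: inj_on_puncture puncture_image)
qed

section \<open>Distance and locality\<close>

lemma hamming_dist_puncture_le:
  assumes "x \<in> carrier_vec (lengthened_dim n r)"
  shows "hamming_dist (puncture n r x) (puncture n r y) \<le> hamming_dist x y"
  unfolding hamming_dist_def
  \<comment> \<open>\<open>data_index r\<close> injects the positions where the punctured words
    differ into those where x and y differ.\<close>
  by (rule card_inj_on_le[OF inj_data_index[OF r]])
     (use assms in \<open>auto simp: data_index_less[OF n r]\<close>)

text \<open>The repair set of p is the rest of its block: the zero block sum determines the entry at
  p from the others.\<close>

lemma has_locality_lengthened: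
  "has_locality (lengthened_dim n r) r (mat_kernel (lengthened_matrix H0 r))"
  unfolding has_locality_def
proof (intro allI impI exI conjI ballI)
  fix p
  assume p: "p < lengthened_dim n r"
  let ?B = "block_indices n r (p div Suc r)"
  have pB: "p \<in> ?B"
    using p by (simp add: block_indices_def)
  show "?B - {p} \<subseteq> {..<lengthened_dim n r} - {p}"
    by (auto simp: block_indices_def)
  show "card (?B - {p}) \<le> r"
    using pB card_block_indices_le[OF n r, of "p div Suc r"] finite_block_indices
    by simp
  fix x y
  assume x: "x \<in> mat_kernel (lengthened_matrix H0 r)"
    and y: "y \<in> mat_kernel (lengthened_matrix H0 r)"
    and eq: "\<forall>j\<in>?B - {p}. x $ j = y $ j"
  have "sum (($) x) ?B = sum (($) y) ?B"
    using x y block_of_index(1)[OF n r p] by (simp add: mem_lengthened_kernel_iff)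
  moreover have "sum (($) x) (?B - {p}) = sum (($) y) (?B - {p})"
    using eq by (intro sum.cong) auto
  ultimately show "x $ p = y $ p"
    using pB by (simp add: sum.remove[OF finite_block_indices pB])
qed

end

section \<open>Codes given by parity-check matrices\<close>

lemma subspace_mat_kernel:
  fixes A :: "'a::field mat"
  assumes "A \<in> carrier_mat a n"
  shows "VectorSpace.subspace class_ring (mat_kernel A) (module_vec TYPE('a) n)"
proof -
  interpret kernel a n A
    by unfold_locales (rule assms)
  have "submodule class_ring (mat_kernel A) NC.V"
    by unfold_locales
       (insert assms mult_add_distrib_mat_vec[OF assms] mult_mat_vec[OF assms] mat_kernel[OF assms],
        auto simp: class_ring_simps)
  then show ?thesis
    by (intro VectorSpace.subspace.intro NC.vectorspace_axioms)
qed

text \<open>Distances are bounded by the word length n, so the \<open>Min\<close> in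
  \<open>min_dist\<close> is taken over a finite set.\<close>

lemma finite_hamming_dists:
  assumes "C \<subseteq> carrier_vec n"
  shows "finite {hamming_dist x y | x y. x \<in> C \<and> y \<in> C \<and> x \<noteq> y}"
proof (rule finite_subset)
  show "{hamming_dist x y | x y. x \<in> C \<and> y \<in> C \<and> x \<noteq> y} \<subseteq> {..n}"
  proof clarify
    fix x y
    assume "x \<in> C"
    with assms have "dim_vec x = n"
      by auto
    then have "{i. i < dim_vec x \<and> x $ i \<noteq> y $ i} \<subseteq> {..<n}"
      by auto
    then have "hamming_dist x y \<le> card {..<n}"
      unfolding hamming_dist_def by (rule card_mono[OF finite_lessThan])
    then show "hamming_dist x y \<le> n"
      by simp
  qed
qed simp

lemma min_dist_le:
  assumes "C \<subseteq> carrier_vec n" "x \<in> C" "y \<in> C" "x \<noteq> y"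
  shows "min_dist C \<le> hamming_dist x y"
  unfolding min_dist_def using assms(2-) by (intro Min_le finite_hamming_dists[OF assms(1)]) auto

text \<open>The distinct words u and v keep the set of distances nonempty, so its \<open>Min\<close>
  is a member.\<close>

lemma min_dist_attained:
  assumes "C \<subseteq> carrier_vec n" "u \<in> C" "v \<in> C" "u \<noteq> v"
  obtains x y where "x \<in> C" "y \<in> C" "x \<noteq> y" "min_dist C = hamming_dist x y"
proof -
  have "min_dist C \<in> {hamming_dist x y | x y. x \<in> C \<and> y \<in> C \<and> x \<noteq> y}"
    unfolding min_dist_def using assms(2-) by (intro Min_in finite_hamming_dists[OF assms(1)]) auto
  then show thesis
    using that by blast
qed

theorem proposition4p2:
  fixes H0 :: "'a::{field,finite} mat"
    and C0 C :: "'a vec set"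
    and n k d r :: nat
  assumes "nkd_code n k d C0"
    and "H0 \<in> carrier_mat (n - k) n"
    and "parity_check_matrix H0 C0"
    and "0 < r"
    and "parity_check_matrix (lengthened_matrix H0 r) C"
  shows "lrc_at_least (n + nat \<lceil>real n / real r\<rceil>) k d r C"
proof -
  note H0 = assms(2) and r = assms(4)
  have C0: "C0 = mat_kernel H0" and C: "C = mat_kernel (lengthened_matrix H0 r)"
    using assms by (simp_all add: parity_check_matrix_def)
  have nontriv: "C0 \<noteq> {0\<^sub>v n}" and d: "min_dist C0 = d"
    and dim: "vectorspace.dim class_ring ((module_vec TYPE('a) n)\<lparr>carrier := C0\<rparr>) = k"
    using assms(1) by (simp_all add: nkd_code_def linear_code_def)
  have C0n: "C0 \<subseteq> carrier_vec n"
    unfolding C0 by (rule mat_kernel_carrier[OF H0])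
  have zero: "0\<^sub>v n \<in> C0"
    unfolding C0 using H0 by (auto intro!: mat_kernelI[OF H0])
  obtain w where w: "w \<in> C0" "w \<noteq> 0\<^sub>v n"
    using nontriv zero by blast
  \<comment> \<open>There is only one vector of dimension 0, so the nonzero codeword w forces
    positive length, as the block decomposition requires.\<close>
  have "w = 0\<^sub>v n" if "n = 0"
    using subsetD[OF C0n w(1)] that by (intro eq_vecI) auto
  then have n: "0 < n"
    using w(2) by blast
  note carr = lengthened_matrix_carrier'[OF H0 n r]
  have CN: "C \<subseteq> carrier_vec (lengthened_dim n r)"
    unfolding C by (rule mat_kernel_carrier[OF carr])
  have inj: "inj_on (puncture n r) C" and image: "puncture n r ` C = C0"
    unfolding C C0 by (rule inj_on_puncture[OF H0 n r], rule puncture_image[OF H0 n r])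
  \<comment> \<open>Preimages of w and of the zero word under puncturing. They show that
    \<open>C\<close> is nontrivial and that its minimum distance is attained.\<close>
  obtain u v where uv: "u \<in> C" "v \<in> C" "u \<noteq> v"
    using w zero unfolding image[symmetric] by (metis imageE)
  have "linear_code (lengthened_dim n r) k C"
    unfolding linear_code_def
  proof (intro conjI)
    show "VectorSpace.subspace class_ring C (module_vec TYPE('a) (lengthened_dim n r))"
      unfolding C by (rule subspace_mat_kernel[OF carr])
    show "C \<noteq> {0\<^sub>v (lengthened_dim n r)}"
      using uv by auto
    show "vectorspace.dim class_ring
        ((module_vec TYPE('a) (lengthened_dim n r))\<lparr>carrier := C\<rparr>) = k"
      using dim unfolding C C0 dim_lengthened_kernel[OF H0 n r] .
  qed
  moreover have "d \<le> min_dist C"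
  proof -
    \<comment> \<open>For a closest pair of \<open>C\<close>, injectivity of puncturing keeps the
      images distinct, so they are at least d apart in \<open>C0\<close>.\<close>
    obtain x y where xy: "x \<in> C" "y \<in> C" "x \<noteq> y" "min_dist C = hamming_dist x y"
      using min_dist_attained[OF CN uv] .
    have "d \<le> hamming_dist (puncture n r x) (puncture n r y)"
      unfolding d[symmetric] using xy(1-3) inj image
      by (intro min_dist_le[OF C0n]) (auto dest: inj_onD)
    also have "\<dots> \<le> hamming_dist x y"
      using xy(1) CN by (intro hamming_dist_puncture_le[OF H0 n r]) auto
    finally show ?thesis
      using xy(4) by simp
  qed
  moreover have "has_locality (lengthened_dim n r) r C"
    unfolding C by (rule has_locality_lengthened[OF H0 n r])
  ultimately show ?thesis
    by (simp add: lrc_at_least_def lengthened_dim_ceiling[OF n r])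
qed

end
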